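(* Let $n\ge 4$ and $1\le k\le \frac n2$ be integers. Let $x,y$ be integers with $0\le x\le k-1$ and $0\le y\le k$. Then the number of $k$-subsets of $C_n=\mathbb{Z}/n\mathbb{Z}$ that have exactly $x$ incidences at distance $1$ and exactly $y$ incidences at distance $2$ is equal to $$\binom{n}{k}P(D_1=x,D_2=y)=\frac{n}{k-x}\sum_{a+b=k+y-2x}\binom{k-x}{a}\binom{x-1}{k-x-a-1}\binom{k-x}{b}\binom{n-2k+x-1}{k-x-b-1},$$ where the sum ranges over all pairs of nonnegative integers $(a,b)$ with $a+b=k+y-2x$.
   Context: For a $k$-subset $A$ (subset of cardinality $k$) of $C_n=\mathbb{Z}/n\mathbb{Z}$ with $0,1$-indicator function $f$, the number of incidences of $A$ at distance $j$ is the periodic autocorrelation value $\sigma_j(f)=\sum_{t\in C_n}f(t)f(t+j)$ (indices modulo $n$), i.e. the number of $t\in A$ with $t+j\in A$. $P$ is the uniform probability on the $\binom nk$ $k$-subsets of $C_n$, and $D_j$ is the random variable giving the number of incidences at distance $j$, for $1\le j\le \lfloor n/2\rfloor$. Convention for binomial coefficients with integer entries: $\binom{t}{t}=1$ for all integers $t$, including negative ones (e.g. $\binom{-1}{-1}=1$); for $s\ne t$, $\binom{t}{s}=0$ whenever $s<0$ or $s>t$ (so e.g. $\binom{-1}{0}=0$); otherwise $\binom ts$ has its usual value. *)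

theory Defs
  imports "HOL-Probability.Probability"
begin

text \<open>The cyclic group of order \<open>n\<close> is represented by the residues \<open>{..<n}\<close>,
  with addition modulo \<open>n\<close>.\<close>

definition k_subsets :: "nat \<Rightarrow> nat \<Rightarrow> nat set set" where
  "k_subsets n k = {A. A \<subseteq> {..<n} \<and> card A = k}"

definition autocorr :: "nat \<Rightarrow> (nat \<Rightarrow> int) \<Rightarrow> nat \<Rightarrow> int" where
  "autocorr n f j = (\<Sum>t<n. f t * f ((t + j) mod n))"

definition incidences :: "nat \<Rightarrow> nat \<Rightarrow> nat set \<Rightarrow> int" where
  "incidences n j A = autocorr n (indicator A) j"

definition uniform_k_subset :: "nat \<Rightarrow> nat \<Rightarrow> nat set pmf" where
  "uniform_k_subset n k = pmf_of_set (k_subsets n k)"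

text \<open>Binomial coefficients with integer entries, normalised so that \<open>int_binom t t = 1\<close> for
  every integer \<open>t\<close>, including negative ones. This differs from \<open>gbinomial\<close>; for instance
  \<open>int_binom (-1) (-1) = 1\<close> and \<open>int_binom (-1) 0 = 0\<close>.\<close>

definition int_binom :: "int \<Rightarrow> int \<Rightarrow> int" where
  "int_binom t s =
     (if s = t then 1 else if s < 0 \<or> s > t then 0 else int (nat t choose nat s))"

end

theory Submission
  imports Defs "HOL-Number_Theory.Cong"
begin

text \<open>View a subset as a cyclic binary word. A word with \<open>k\<close> ones and \<open>x\<close> incidences at distance 1
  has \<open>r = k - x\<close> runs of ones, hence \<open>r\<close> ascents. An incidence at distance 2 comes either from three
  consecutive ones or from a run of zeros of length 1; if \<open>a\<close> runs of ones and \<open>b\<close> runs of zeros have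
  length 1, there are \<open>(k - 2r + a) + b\<close> of them, so \<open>a + b = k + y - 2x\<close>. Counting pairs of a word and
  one of its ascents, and rotating the ascent to the boundary of the word, gives
  \<open>r \<cdot> #words = n \<cdot> #(linear words starting with 1 and ending with 0)\<close>; such a linear word is a pair of
  compositions of \<open>k\<close> and \<open>n - k\<close> into \<open>r\<close> parts with \<open>a\<close> respectively \<open>b\<close> parts equal to 1.
  Run lengths are stored diminished by one, so parts equal to 1 become zeros.\<close>

section \<open>Lists with prescribed sum and number of zeros\<close>

definition sum_zeros_lists :: "nat \<Rightarrow> nat \<Rightarrow> nat \<Rightarrow> nat list set" where
  "sum_zeros_lists r s a = {ps. length ps = r \<and> sum_list ps = s \<and> count_list ps 0 = a}"

lemma finite_sum_zeros_lists: "finite (sum_zeros_lists r s a)"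
proof (rule finite_subset)
  show "sum_zeros_lists r s a \<subseteq> {ps. set ps \<subseteq> {..s} \<and> length ps = r}"
    using member_le_sum_list unfolding sum_zeros_lists_def by fastforce
  show "finite {ps. set ps \<subseteq> {..s} \<and> length ps = r}"
    by (rule finite_lists_length_eq) simp
qed

lemma int_binom_of_nat: "int_binom (int t) (int s) = int (t choose s)"
  unfolding int_binom_def by (auto simp: binomial_eq_0)

text \<open>\<open>int_binom (int s - 1) (int j - 1)\<close> is the number of compositions of \<open>s\<close> into \<open>j\<close>
  positive parts, also in the degenerate cases \<open>s = 0\<close> or \<open>j = 0\<close>; this is what the
  convention \<open>int_binom (-1) (-1) = 1\<close> achieves.\<close>

lemma int_binom_compositions_0: "int_binom (int s - 1) (- 1) = of_bool (s = 0)"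
  unfolding int_binom_def by auto

text \<open>A composition of \<open>s\<close> into \<open>j + 1\<close> positive parts is a
  composition of some \<open>u < s\<close> into \<open>j\<close> parts together with the part
  \<open>s - u\<close>.\<close>

lemma int_binom_compositions_Suc:
  "(\<Sum>u<s. int_binom (int u - 1) (int j - 1)) = int_binom (int s - 1) (int j)"
proof (induction s)
  case 0
  show ?case by (simp add: int_binom_def)
next
  case (Suc s)
  \<comment> \<open>Pascal's rule; for \<open>s = j = 0\<close> it rests on
    \<open>int_binom (-1) (-1) = 1\<close>.\<close>
  have "int_binom (int s - 1) (int j) + int_binom (int s - 1) (int j - 1) = int_binom (int s) (int j)"
  proof (cases s)
    case 0
    then show ?thesis by (cases j) (auto simp: int_binom_def)
  next
    case s: (Suc t)
    show ?thesis
    proof (cases j)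
      case 0
      then show ?thesis using int_binom_of_nat[of t 0] int_binom_of_nat[of s 0]
        by (simp add: s int_binom_compositions_0[of "Suc t", simplified])
    next
      case (Suc i)
      then show ?thesis
        using int_binom_of_nat[of t i] int_binom_of_nat[of t j] int_binom_of_nat[of s j]
        by (simp add: s)
    qed
  qed
  then show ?case using Suc.IH by simp
qed

text \<open>The first entry is zero or a positive \<open>s - u\<close>, with \<open>u\<close> the
  sum of the rest. The guard \<open>a > 0\<close> matters because \<open>a - 1\<close>
  truncates.\<close>

lemma sum_zeros_lists_Suc:
  "sum_zeros_lists (Suc r) s a =
     (#) 0 ` {ps \<in> sum_zeros_lists r s (a - 1). a > 0} \<union>
     (\<Union>u<s. (#) (s - u) ` sum_zeros_lists r u a)" (is "?L = ?R")
proof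
  show "?L \<subseteq> ?R"
  proof
    fix l assume l: "l \<in> ?L"
    then obtain p ps where lp: "l = p # ps" "length ps = r"
      unfolding sum_zeros_lists_def by (auto simp: length_Suc_conv)
    show "l \<in> ?R"
    proof (cases "p = 0")
      case True
      then show ?thesis using l lp unfolding sum_zeros_lists_def by auto
    next
      case False
      then have "ps \<in> sum_zeros_lists r (s - p) a" "s - p < s" "p = s - (s - p)"
        using l lp unfolding sum_zeros_lists_def by auto
      then show ?thesis using lp by blast
    qed
  qed
  show "?R \<subseteq> ?L" unfolding sum_zeros_lists_def by auto
qed

text \<open>One factor chooses the positions of the zeros, the other the composition of
  \<open>s\<close> formed by the \<open>r - a\<close> positive entries.\<close>

lemma card_sum_zeros_lists:
  "int (card (sum_zeros_lists r s a)) =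
     int_binom (int r) (int a) * int_binom (int s - 1) (int r - int a - 1)"
proof (induction r arbitrary: s a)
  case 0
  have "sum_zeros_lists 0 s a = (if s = 0 \<and> a = 0 then {[]} else {})"
    unfolding sum_zeros_lists_def by auto
  then show ?case
    using int_binom_of_nat[of 0 a] int_binom_compositions_0[of s] by (cases a) auto
next
  case (Suc r)
  let ?Z = "(#) 0 ` {ps \<in> sum_zeros_lists r s (a - 1). a > 0}"
  let ?P = "\<lambda>u. (#) (s - u) ` sum_zeros_lists r u a"
  have "card (\<Union>u<s. ?P u) = (\<Sum>u<s. card (?P u))"
    by (rule card_UN_disjoint) (auto simp: finite_sum_zeros_lists)
  also have "\<dots> = (\<Sum>u<s. card (sum_zeros_lists r u a))"
    by (intro sum.cong refl card_image) auto
  finally have P: "int (card (\<Union>u<s. ?P u)) =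
      (\<Sum>u<s. int_binom (int r) (int a) * int_binom (int u - 1) (int r - int a - 1))"
    using Suc.IH by simp
  have P': "int (card (\<Union>u<s. ?P u)) =
      int_binom (int r) (int a) * int_binom (int s - 1) (int r - int a)"
  \<comment> \<open>For \<open>a > r\<close> the first factor vanishes; otherwise
    \<open>r - a\<close> is a natural number of parts.\<close>
  proof (cases "a \<le> r")
    case True
    then show ?thesis
      using P int_binom_compositions_Suc[of "r - a" s] by (simp add: sum_distrib_left[symmetric] of_nat_diff)
  next
    case False
    then show ?thesis using P int_binom_of_nat[of r a] by (simp add: binomial_eq_0)
  qed
  have Z: "card ?Z = (if a > 0 then card (sum_zeros_lists r s (a - 1)) else 0)"
    by (subst card_image) auto
  have "card (sum_zeros_lists (Suc r) s a) = card ?Z + card (\<Union>u<s. ?P u)"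
    unfolding sum_zeros_lists_Suc
    by (rule card_Un_disjoint) (auto simp: finite_sum_zeros_lists)
  then have split: "int (card (sum_zeros_lists (Suc r) s a)) =
      int (if a > 0 then card (sum_zeros_lists r s (a - 1)) else 0) +
      int_binom (int r) (int a) * int_binom (int s - 1) (int r - int a)"
    using Z P' by simp
  show ?case
  proof (cases a)
    case 0
    then show ?thesis
      using split int_binom_of_nat[of r 0] int_binom_of_nat[of "Suc r" 0] by simp
  next
    \<comment> \<open>Pascal's rule in the first factor; the second is common, since
      \<open>r - b - 1 = r - a\<close>.\<close>
    case (Suc b)
    then show ?thesis
      using split Suc.IH[of s b] int_binom_of_nat[of r b] int_binom_of_nat[of r a]
        int_binom_of_nat[of "Suc r" a]
      by (simp add: algebra_simps)
  qed
qed

section \<open>Periodic autocorrelation of binary words\<close>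

definition cyc_corr :: "nat \<Rightarrow> bool list \<Rightarrow> nat" where
  "cyc_corr j w = (\<Sum>t<length w. of_bool (w ! t \<and> w ! ((t + j) mod length w)))"

definition lin_corr :: "nat \<Rightarrow> bool list \<Rightarrow> nat" where
  "lin_corr j w = (\<Sum>t<length w - j. of_bool (w ! t \<and> w ! (t + j)))"

lemma bij_betw_add_mod: "bij_betw (\<lambda>t. (t + m) mod n) {..<n} {..<n::nat}"
proof (cases "n = 0")
  case False
  have "inj_on (\<lambda>t. (t + m) mod n) {..<n}"
  proof (rule inj_onI)
    fix s t assume "s \<in> {..<n}" "t \<in> {..<n}" "(s + m) mod n = (t + m) mod n"
    then show "s = t"
      by (metis cong_def cong_add_rcancel_nat lessThan_iff mod_less)
  qed
  moreover have "(\<lambda>t. (t + m) mod n) ` {..<n} \<subseteq> {..<n}" using False by auto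
  ultimately show ?thesis
    by (simp add: bij_betw_def endo_inj_surj)
qed (simp add: bij_betw_def)

lemma cyc_corr_rotate: "cyc_corr j (rotate m w) = cyc_corr j w"
proof -
  let ?n = "length w"
  have "cyc_corr j (rotate m w) =
      (\<Sum>t<?n. of_bool (w ! ((t + m) mod ?n) \<and> w ! (((t + m) mod ?n + j) mod ?n)))"
    unfolding cyc_corr_def length_rotate
  proof (rule sum.cong[OF refl])
    fix t assume "t \<in> {..<?n}"
    then have t: "t < ?n" "(t + j) mod ?n < ?n" by (auto intro: mod_less_divisor)
    have "(m + (t + j) mod ?n) mod ?n = ((t + m) mod ?n + j) mod ?n"
      by (simp add: mod_simps ac_simps)
    then show "of_bool (rotate m w ! t \<and> rotate m w ! ((t + j) mod ?n)) =
        (of_bool (w ! ((t + m) mod ?n) \<and> w ! (((t + m) mod ?n + j) mod ?n)) :: nat)"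
      using t by (simp add: nth_rotate add.commute)
  qed
  also have "\<dots> = (\<Sum>t<?n. of_bool (w ! t \<and> w ! ((t + j) mod ?n)))"
    by (rule sum.reindex_bij_betw[OF bij_betw_add_mod])
  finally show ?thesis by (simp add: cyc_corr_def)
qed

section \<open>Ascents of cyclic words and double counting\<close>

definition ascents :: "bool list \<Rightarrow> nat set" where
  "ascents w = {t. t < length w \<and> \<not> w ! t \<and> w ! (Suc t mod length w)}"

text \<open>Every one is preceded cyclically by a zero, giving an ascent, or by a one, giving an
  incidence at distance 1.\<close>

lemma card_ascents: "card (ascents w) + cyc_corr 1 w = cyc_corr 0 w"
proof -
  let ?n = "length w"
  have "cyc_corr 0 w = (\<Sum>t<?n. of_bool (w ! t))"
    by (simp add: cyc_corr_def)
  also have "\<dots> = (\<Sum>t<?n. of_bool (w ! ((t + 1) mod ?n)))"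
    by (rule sum.reindex_bij_betw[OF bij_betw_add_mod, symmetric])
  also have "\<dots> = (\<Sum>t<?n. of_bool (t \<in> ascents w) +
      of_bool (w ! t \<and> w ! ((t + 1) mod ?n)))"
    by (rule sum.cong) (auto simp: ascents_def)
  also have "\<dots> = (\<Sum>t<?n. of_bool (t \<in> ascents w)) + cyc_corr 1 w"
    by (simp add: sum.distrib cyc_corr_def)
  also have "(\<Sum>t<?n. of_bool (t \<in> ascents w)) = card ({..<?n} \<inter> ascents w)"
    by (simp add: Int_def)
  also have "{..<?n} \<inter> ascents w = ascents w"
    by (auto simp: ascents_def)
  finally show ?thesis by simp
qed

text \<open>Rotation by \<open>Suc t\<close> makes position \<open>t\<close> the last letter and its
  successor the first, so the ascent straddles the boundary.\<close>

lemma card_ascent_words: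
  assumes inv: "\<And>m w. w \<in> X \<Longrightarrow> rotate m w \<in> X"
    and len: "\<And>w. w \<in> X \<Longrightarrow> length w = n"
    and t: "t < n"
  shows "card {w \<in> X. t \<in> ascents w} = card {w \<in> X. hd w \<and> \<not> last w}"
proof (rule bij_betw_same_card)
  let ?f = "rotate (Suc t) :: bool list \<Rightarrow> _" and ?g = "rotate (n - Suc t) :: bool list \<Rightarrow> _"
  have n0: "n > 0" using t by simp
  have ends: "hd (?f w) = w ! (Suc t mod n) \<and> last (?f w) = w ! t" if "length w = n" for w
  proof -
    have "hd (?f w) = ?f w ! 0" using that n0 by (intro hd_conv_nth) auto
    moreover have "last (?f w) = ?f w ! (n - 1)"
      using that n0 by (subst last_conv_nth) auto
    moreover have "(Suc t + (n - 1)) mod n = t" using t by simp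
    ultimately show ?thesis using that n0
      by (simp only: nth_rotate) simp
  qed
  have fg: "?f (?g w) = w" "?g (?f w) = w" if "length w = n" for w
    using that t by (simp_all add: rotate_rotate del: rotate_Suc)
  show "bij_betw ?f {w \<in> X. t \<in> ascents w} {w \<in> X. hd w \<and> \<not> last w}"
  proof (rule bij_betw_byWitness[where f' = ?g])
    show "\<forall>w\<in>{w \<in> X. t \<in> ascents w}. ?g (?f w) = w" 
      and "\<forall>w\<in>{w \<in> X. hd w \<and> \<not> last w}. ?f (?g w) = w"
      using fg len by blast+
    show "?f ` {w \<in> X. t \<in> ascents w} \<subseteq> {w \<in> X. hd w \<and> \<not> last w}"
      using ends len inv by (auto simp: ascents_def simp del: rotate_Suc)
    have "t \<in> ascents (?g w)" if "w \<in> X" "hd w" "\<not> last w" for w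
      using ends[of "?g w"] fg(1)[of w] len[of w] that t by (simp add: ascents_def del: rotate_Suc)
    then show "?g ` {w \<in> X. hd w \<and> \<not> last w} \<subseteq> {w \<in> X. t \<in> ascents w}"
      using inv by blast
  qed
qed

text \<open>Double counting of pairs of a word and one of its ascents; every position contributes
  equally.\<close>

lemma card_words_ascents:
  assumes fin: "finite X"
    and inv: "\<And>m w. w \<in> X \<Longrightarrow> rotate m w \<in> X"
    and len: "\<And>w. w \<in> X \<Longrightarrow> length w = n"
    and asc: "\<And>w. w \<in> X \<Longrightarrow> card (ascents w) = r"
  shows "r * card X = n * card {w \<in> X. hd w \<and> \<not> last w}"
proof -
  have sub: "ascents w = {t \<in> {..<n}. t \<in> ascents w}" if "w \<in> X" for w
    using len[OF that] by (auto simp: ascents_def)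
  have "r * card X = (\<Sum>w\<in>X. card {t \<in> {..<n}. t \<in> ascents w})"
    using asc sub by simp
  also have "\<dots> = (\<Sum>t<n. card {w \<in> X. t \<in> ascents w})"
    by (rule sum_multicount_gen) (use fin in auto)
  also have "\<dots> = (\<Sum>t<n. card {w \<in> X. hd w \<and> \<not> last w})"
    using card_ascent_words[OF inv len] by (intro sum.cong) auto
  finally show ?thesis by simp
qed

section \<open>Run-length encoding\<close>

text \<open>\<open>Suc\<close> restores the true run lengths. No run is empty, so the encoding is
  unique on pairs of lists of equal length.\<close>

fun runs :: "nat list \<Rightarrow> nat list \<Rightarrow> bool list" where
  "runs (p # ps) (q # qs) = replicate (Suc p) True @ replicate (Suc q) False @ runs ps qs"
| "runs _ _ = []"

lemma length_runs:
  "length ps = length qs \<Longrightarrow>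
    length (runs ps qs) = sum_list ps + sum_list qs + 2 * length ps"
  by (induction ps qs rule: list_induct2) auto

lemma runs_ends:
  assumes "length ps = length qs" "ps \<noteq> []"
  shows "runs ps qs \<noteq> [] \<and> hd (runs ps qs) \<and> \<not> last (runs ps qs)"
  using assms
proof (induction ps qs rule: list_induct2)
  case (Cons p ps q qs)
  then show ?case by (cases "ps = []") auto
qed simp

lemma runs_hd: "hd (runs ps qs @ [True])"
  by (cases "(ps, qs)" rule: runs.cases) auto

text \<open>The initial block is maximal because what follows does not begin with \<open>b\<close>;
  hence the word determines it.\<close>

lemma replicate_append_inj:
  assumes "replicate m b @ u = replicate m' b @ u'"
    and "u \<noteq> [] \<Longrightarrow> hd u \<noteq> b" "u' \<noteq> [] \<Longrightarrow> hd u' \<noteq> b"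
  shows "m = m' \<and> u = u'"
  using assms
proof (induction m arbitrary: m')
  case 0
  then show ?case by (cases m') auto
next
  case (Suc m)
  then show ?case by (cases m') auto
qed

lemma runs_inj:
  assumes "length ps = length qs" "length ps' = length qs'" "runs ps qs = runs ps' qs'"
  shows "ps = ps' \<and> qs = qs'"
  using assms
proof (induction ps qs arbitrary: ps' qs' rule: list_induct2)
  case Nil
  then show ?case by (cases "(ps', qs')" rule: runs.cases) auto
next
  case (Cons p ps q qs)
  then obtain p' ps1 q' qs1 where p': "ps' = p' # ps1" "qs' = q' # qs1" "length ps1 = length qs1"
    by (cases "(ps', qs')" rule: runs.cases) auto
  let ?u = "replicate (Suc q) False @ runs ps qs"
  let ?u' = "replicate (Suc q') False @ runs ps1 qs1"
  have "replicate (Suc p) True @ ?u = replicate (Suc p') True @ ?u'"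
    using Cons.prems(2) p' by simp
  then have 1: "Suc p = Suc p' \<and> ?u = ?u'"
    by (rule replicate_append_inj) auto
  have hd: "hd (runs as bs) \<noteq> False" if "runs as bs \<noteq> []" for as bs
    using runs_hd[of as bs] that by simp
  from 1 have "Suc q = Suc q' \<and> runs ps qs = runs ps1 qs1"
    using hd by (intro replicate_append_inj) blast+
  then show ?case using Cons.IH[OF p'(3)] 1 p' by simp
qed

lemma takeWhile_replicate: "takeWhile ((=) b) w = replicate (length (takeWhile ((=) b) w)) b"
  by (induction w) auto

text \<open>Stripping the leading block of ones and then that of zeros leaves a shorter word which
  is empty or has the same end letters.\<close>

lemma word_is_runs:
  assumes "w = [] \<or> hd w \<and> \<not> last w"
  shows "\<exists>ps qs. length ps = length qs \<and> w = runs ps qs"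
  using assms
proof (induction "length w" arbitrary: w rule: less_induct)
  case less
  show ?case
  proof (cases "w = []")
    case True
    then have "length [] = length [] \<and> w = runs [] []" by simp
    then show ?thesis by blast
  next
    case False
    define u where "u = dropWhile ((=) True) w"
    define v where "v = dropWhile ((=) False) u"
    define p where "p = length (takeWhile ((=) True) w)"
    define q where "q = length (takeWhile ((=) False) u)"
    have w: "w = replicate p True @ u"
      unfolding u_def p_def by (metis takeWhile_dropWhile_id takeWhile_replicate)
    have u: "u = replicate q False @ v"
      unfolding v_def q_def by (metis takeWhile_dropWhile_id takeWhile_replicate)
    have ends: "hd w" "\<not> last w" using less.prems False by auto
    have p: "p \<noteq> 0" using ends False unfolding p_def by (cases w) auto
    \<comment> \<open>Otherwise \<open>w\<close> would consist of ones only and end with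
      \<open>True\<close>.\<close>
    have u0: "u \<noteq> []" using w ends p by auto
    have "\<not> hd u" using u0 hd_dropWhile[of "(=) True" w] unfolding u_def by auto
    then have q: "q \<noteq> 0" using u0 unfolding q_def by (cases u) auto
    have "hd v" if "v \<noteq> []" using that hd_dropWhile[of "(=) False" u] unfolding v_def by auto
    moreover have "\<not> last v" if "v \<noteq> []" using that ends(2) w u by simp
    moreover have "length v < length w" using w u p by simp
    ultimately obtain ps qs where "length ps = length qs" "v = runs ps qs"
      using less.hyps by blast
    then have "length ((p - 1) # ps) = length ((q - 1) # qs) \<and> w = runs ((p - 1) # ps) ((q - 1) # qs)"
      using w u p q by simp
    then show ?thesis by blast
  qed
qed

section \<open>Autocorrelations in terms of run lengths\<close>

lemma lin_corr_Cons:
  assumes "j \<le> length u"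
  shows "lin_corr j (a # u) = of_bool (a \<and> (a # u) ! j) + lin_corr j u"
  using assms unfolding lin_corr_def
  by (simp add: Suc_diff_le sum.lessThan_Suc_shift del: sum.lessThan_Suc sum_of_bool_eq)

lemma lin_corr_False: "lin_corr j (replicate m False @ u) = lin_corr j u"
proof (induction m)
  case (Suc m)
  show ?case
  proof (cases "j \<le> m + length u")
    case True
    then show ?thesis using Suc.IH by (simp add: lin_corr_Cons)
  next
    case False
    then show ?thesis by (simp add: lin_corr_def)
  qed
qed simp

text \<open>Appending \<open>True\<close> to a word that starts with \<open>True\<close> and ends with \<open>False\<close> accounts for the
  wrap-around up to distance 2.\<close>

lemma cyc_corr_lin_corr:
  assumes "w \<noteq> []" "hd w" "\<not> last w"
  shows "Suc (cyc_corr 0 w) = lin_corr 0 (w @ [True])"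
    and "cyc_corr 1 w = lin_corr 1 (w @ [True])"
    and "cyc_corr 2 w = lin_corr 2 (w @ [True])"
proof -
  have "length w \<noteq> 1" using assms by (cases w) auto
  moreover have "length w \<noteq> 0" using assms by simp
  ultimately obtain m where m: "length w = Suc (Suc m)"
    by (metis One_nat_def not0_implies_Suc)
  have 0: "w ! 0" using assms by (simp add: hd_conv_nth)
  have l: "\<not> w ! Suc m" using assms m by (simp add: last_conv_nth)
  \<comment> \<open>At distance 0 the appended letter pairs with itself, whence the
    \<open>Suc\<close>.\<close>
  show "Suc (cyc_corr 0 w) = lin_corr 0 (w @ [True])"
    by (simp add: cyc_corr_def lin_corr_def nth_append)
  show "cyc_corr 1 w = lin_corr 1 (w @ [True])"
    using l by (simp add: cyc_corr_def lin_corr_def nth_append m)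
  \<comment> \<open>Only the last two positions wrap. Position \<open>m\<close> meets
    \<open>w ! 0\<close>, which is \<open>True\<close> like the appended letter;
    \<open>w ! Suc m\<close> is \<open>False\<close>.\<close>
  have "(\<Sum>t<m. of_bool (w ! t \<and> w ! ((t + 2) mod Suc (Suc m)))) =
      (\<Sum>t<m. of_bool (w ! t \<and> w ! (t + 2)) :: nat)"
    by (intro sum.cong) auto
  then show "cyc_corr 2 w = lin_corr 2 (w @ [True])"
    using 0 l by (simp add: cyc_corr_def lin_corr_def nth_append m)
qed

text \<open>A run of \<open>p + 1\<close> ones has \<open>p\<close> incidences at distance 1 and
  \<open>p - 1\<close> (truncated) at distance 2; a lone zero between ones adds one at distance 2.
  Adding \<open>length ps\<close> turns truncation into the count of zeros in
  \<open>ps\<close>.\<close>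

lemma lin_corr_runs:
  assumes "length ps = length qs"
  shows "lin_corr 0 (runs ps qs @ [True]) = Suc (sum_list ps + length ps)"
    and "lin_corr 1 (runs ps qs @ [True]) = sum_list ps"
    and "lin_corr 2 (runs ps qs @ [True]) + length ps =
           sum_list ps + count_list ps 0 + count_list qs 0"
proof -
  have step: "lin_corr 0 (replicate (Suc p) True @ replicate (Suc q) False @ v) =
        Suc p + lin_corr 0 v \<and>
      lin_corr 1 (replicate (Suc p) True @ replicate (Suc q) False @ v) = p + lin_corr 1 v \<and>
      lin_corr 2 (replicate (Suc p) True @ replicate (Suc q) False @ v) =
        p - 1 + of_bool (q = 0) + lin_corr 2 v"
    if v: "v \<noteq> []" "hd v" for p q v
  proof (induction p)
    case 0
    obtain z where z: "v = True # z" using v by (cases v) auto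
    define u where "u = replicate (Suc q) False @ v"
    \<comment> \<open>The lone one meets the start of \<open>v\<close> at distance 2 exactly when a
      single zero separates them.\<close>
    have "u ! 1 \<longleftrightarrow> q = 0"
      by (cases q) (auto simp: u_def z)
    moreover have "\<not> u ! 0" "2 \<le> length u"
      by (simp_all add: u_def z)
    moreover have "lin_corr j u = lin_corr j v" for j
      unfolding u_def by (rule lin_corr_False)
    ultimately show ?case
      unfolding u_def[symmetric] by (simp add: lin_corr_Cons numeral_2_eq_2)
  next
    case (Suc p)
    \<comment> \<open>The new leading one meets a one at distance 2 only if the old run had at least
      two ones.\<close>
    then show ?case by (cases p) (auto simp: lin_corr_Cons numeral_2_eq_2)
  qed
  have "lin_corr 0 (runs ps qs @ [True]) = Suc (sum_list ps + length ps) \<and>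
    lin_corr 1 (runs ps qs @ [True]) = sum_list ps \<and>
    lin_corr 2 (runs ps qs @ [True]) + length ps =
           sum_list ps + count_list ps 0 + count_list qs 0"
    using assms
  proof (induction ps qs rule: list_induct2)
    case Nil
    show ?case by (simp add: lin_corr_def)
  next
    case (Cons p ps q qs)
    then show ?case using step[of "runs ps qs @ [True]" p q] runs_hd[of ps qs] by auto
  qed
  then show "lin_corr 0 (runs ps qs @ [True]) = Suc (sum_list ps + length ps)"
    and "lin_corr 1 (runs ps qs @ [True]) = sum_list ps"
    and "lin_corr 2 (runs ps qs @ [True]) + length ps =
           sum_list ps + count_list ps 0 + count_list qs 0"
    by auto
qed

section \<open>Counting words and subsets\<close>

definition corr_words :: "nat \<Rightarrow> nat \<Rightarrow> nat \<Rightarrow> nat \<Rightarrow> bool list set" where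
  "corr_words n k x y =
     {w. length w = n \<and> cyc_corr 0 w = k \<and> cyc_corr 1 w = x \<and> cyc_corr 2 w = y}"

lemma finite_corr_words: "finite (corr_words n k x y)"
  by (rule finite_subset[OF _ finite_lists_length_eq[of UNIV n]]) (auto simp: corr_words_def)

text \<open>With \<open>r = k - x\<close> runs of each letter, the \<open>k\<close> ones leave
  \<open>sum_list ps = x\<close> and the \<open>n - k\<close> zeros leave
  \<open>sum_list qs = n + x - 2 * k\<close>.\<close>

lemma card_corr_words_runs:
  assumes "x < k" "2 * k \<le> n"
  shows "card {w \<in> corr_words n k x y. hd w \<and> \<not> last w} =
    card (\<Union>(a, b) \<in> {(a, b). a + b + 2 * x = k + y}.
      sum_zeros_lists (k - x) x a \<times> sum_zeros_lists (k - x) (n + x - 2 * k) b)"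
    (is "card ?W = card ?U")
proof -
  have mem: "(ps, qs) \<in> ?U \<longleftrightarrow> length ps = k - x \<and> length qs = k - x \<and> sum_list ps = x \<and>
      sum_list qs = n + x - 2 * k \<and> count_list ps 0 + count_list qs 0 + 2 * x = k + y" for ps qs
    by (auto simp: sum_zeros_lists_def)
  have iff: "runs ps qs \<in> corr_words n k x y \<longleftrightarrow> (ps, qs) \<in> ?U"
    if "length ps = length qs" "ps \<noteq> []" for ps qs
  proof -
    note c = cyc_corr_lin_corr[of "runs ps qs"] runs_ends[OF that] lin_corr_runs[OF that(1)]
      length_runs[OF that(1)]
    show ?thesis unfolding mem corr_words_def mem_Collect_eq
      using c that assms by auto
  qed
  have "bij_betw (\<lambda>(ps, qs). runs ps qs) ?U ?W"
  proof (rule bij_betw_imageI)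
    show "inj_on (\<lambda>(ps, qs). runs ps qs) ?U"
    proof (rule inj_onI)
      fix z z'
      assume z: "z \<in> ?U" "z' \<in> ?U"
        "(case z of (ps, qs) \<Rightarrow> runs ps qs) = (case z' of (ps, qs) \<Rightarrow> runs ps qs)"
      obtain ps qs ps' qs' where zz: "z = (ps, qs)" "z' = (ps', qs')"
        by (cases z; cases z')
      then have "length ps = length qs" "length ps' = length qs'"
        using z(1,2) mem by metis+
      then show "z = z'" using runs_inj z(3) zz by simp
    qed
    show "(\<lambda>(ps, qs). runs ps qs) ` ?U = ?W"
    proof
      show "(\<lambda>(ps, qs). runs ps qs) ` ?U \<subseteq> ?W"
      proof
        fix w assume "w \<in> (\<lambda>(ps, qs). runs ps qs) ` ?U"
        then obtain ps qs where z: "w = runs ps qs" "(ps, qs) \<in> ?U" by fast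
        then have "length ps = length qs" "ps \<noteq> []" using mem assms(1) by auto
        then show "w \<in> ?W" using iff runs_ends z by blast
      qed
      show "?W \<subseteq> (\<lambda>(ps, qs). runs ps qs) ` ?U"
      proof
        fix w assume w: "w \<in> ?W"
        then have "w \<noteq> []" using assms by (auto simp: corr_words_def cyc_corr_def)
        moreover obtain ps qs where z: "length ps = length qs" "w = runs ps qs"
          using w word_is_runs by blast
        ultimately have "ps \<noteq> []" by auto
        then have "(ps, qs) \<in> ?U" using iff z w by blast
        then show "w \<in> (\<lambda>(ps, qs). runs ps qs) ` ?U"
          using z by (intro image_eqI[of _ _ "(ps, qs)"]) auto
      qed
    qed
  qed
  then show ?thesis by (simp add: bij_betw_same_card)
qed

lemma card_corr_words:
  assumes "x < k" "2 * k \<le> n"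
  shows "(k - x) * card (corr_words n k x y) =
    n * (\<Sum>(a, b) \<in> {(a, b). a + b + 2 * x = k + y}.
      card (sum_zeros_lists (k - x) x a) * card (sum_zeros_lists (k - x) (n + x - 2 * k) b))"
proof -
  let ?I = "{(a, b). a + b + 2 * x = k + y}"
  have fin: "finite ?I"
    by (rule finite_subset[of _ "{..k + y} \<times> {..k + y}"]) auto
  have "card (\<Union>(a, b) \<in> ?I.
      sum_zeros_lists (k - x) x a \<times> sum_zeros_lists (k - x) (n + x - 2 * k) b) =
    (\<Sum>i \<in> ?I. card (case i of (a, b) \<Rightarrow>
      sum_zeros_lists (k - x) x a \<times> sum_zeros_lists (k - x) (n + x - 2 * k) b))"
    \<comment> \<open>Disjoint, since a pair of lists determines its numbers of zeros
      \<open>a\<close> and \<open>b\<close>.\<close>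
    by (rule card_UN_disjoint[OF fin]) (auto simp: finite_sum_zeros_lists, auto simp: sum_zeros_lists_def)
  also have "\<dots> = (\<Sum>(a, b) \<in> ?I.
      card (sum_zeros_lists (k - x) x a) * card (sum_zeros_lists (k - x) (n + x - 2 * k) b))"
    by (intro sum.cong) (auto simp: card_cartesian_product)
  finally have U: "card {w \<in> corr_words n k x y. hd w \<and> \<not> last w} = \<dots>"
    using card_corr_words_runs[OF assms] by simp
  have "(k - x) * card (corr_words n k x y) =
      n * card {w \<in> corr_words n k x y. hd w \<and> \<not> last w}"
  proof (rule card_words_ascents[OF finite_corr_words])
    show "rotate m w \<in> corr_words n k x y" if "w \<in> corr_words n k x y" for m w
      using that by (simp add: corr_words_def cyc_corr_rotate)
    show "length w = n" if "w \<in> corr_words n k x y" for w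
      using that by (simp add: corr_words_def)
    show "card (ascents w) = k - x" if "w \<in> corr_words n k x y" for w
      using that card_ascents[of w] by (simp add: corr_words_def)
  qed
  then show ?thesis using U by simp
qed

section \<open>From subsets to indicator words\<close>

lemma incidences_cyc_corr:
  "incidences n j A = int (cyc_corr j (map (\<lambda>i. i \<in> A) [0..<n]))"
proof -
  have "(\<Sum>t<n. indicator A t * indicator A ((t + j) mod n) :: int) =
    (\<Sum>t<n. of_bool (map (\<lambda>i. i \<in> A) [0..<n] ! t \<and> map (\<lambda>i. i \<in> A) [0..<n] ! ((t + j) mod n)))"
    by (intro sum.cong) (auto simp: indicator_def)
  then show ?thesis by (simp add: incidences_def autocorr_def cyc_corr_def)
qed

lemma card_subsets_corr_words:
  "card {A \<in> k_subsets n k. incidences n 1 A = int x \<and> incidences n 2 A = int y} =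
     card (corr_words n k x y)"
proof (rule bij_betw_same_card)
  let ?f = "\<lambda>A. map (\<lambda>i. i \<in> A) [0..<n]" and ?g = "\<lambda>w. {i. i < n \<and> w ! i}"
  have c0: "card A = cyc_corr 0 (?f A)" if "A \<subseteq> {..<n}" for A
  proof -
    have "cyc_corr 0 (?f A) = (\<Sum>t<n. of_bool (t \<in> A))"
      unfolding cyc_corr_def by (intro sum.cong) auto
    also have "\<dots> = card ({..<n} \<inter> A)" by (simp add: Int_def)
    finally show ?thesis using that by (simp add: Int_absorb1)
  qed
  have fg: "?f (?g w) = w" if "length w = n" for w
    using that by (intro nth_equalityI) auto
  have "?g w \<in> {A \<in> k_subsets n k. incidences n 1 A = int x \<and> incidences n 2 A = int y}"
    if "w \<in> corr_words n k x y" for w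
    using that fg[of w] c0[of "?g w"]
    by (auto simp: corr_words_def k_subsets_def incidences_cyc_corr)
  then show "bij_betw ?f {A \<in> k_subsets n k. incidences n 1 A = int x \<and> incidences n 2 A = int y}
      (corr_words n k x y)"
    using fg by (intro bij_betw_byWitness[where f' = ?g])
      (auto simp: c0 corr_words_def k_subsets_def incidences_cyc_corr)
qed

lemma prob_uniform_k_subset:
  assumes "k \<le> n"
  shows "real (n choose k) * measure_pmf.prob (uniform_k_subset n k) {A. Q A} =
    real (card {A \<in> k_subsets n k. Q A})"
proof -
  have card: "card (k_subsets n k) = n choose k"
    unfolding k_subsets_def using n_subsets[of "{..<n}" k] by simp
  \<comment> \<open>\<open>k \<le> n\<close> makes the sample space nonempty, so
    \<open>pmf_of_set\<close> is the uniform distribution.\<close>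
  then have pos: "card (k_subsets n k) > 0" using assms by simp
  then have "finite (k_subsets n k)" "k_subsets n k \<noteq> {}"
    using card_gt_0_iff by blast+
  then show ?thesis
    unfolding uniform_k_subset_def using pos
    by (simp add: measure_pmf_of_set card[symmetric] Int_def)
qed

theorem mainTheorem2:
  fixes n k :: nat and x y :: int
  assumes "n \<ge> 4"
    and "1 \<le> k" and "real k \<le> real n / 2"
    and "0 \<le> x" and "x \<le> int k - 1"
    and "0 \<le> y" and "y \<le> int k"
  shows "real (card {A \<in> k_subsets n k. incidences n 1 A = x \<and> incidences n 2 A = y}) =
           real (n choose k) *
             measure_pmf.prob (uniform_k_subset n k)
               {A. incidences n 1 A = x \<and> incidences n 2 A = y}
       \<and> real (n choose k) *
             measure_pmf.prob (uniform_k_subset n k)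
               {A. incidences n 1 A = x \<and> incidences n 2 A = y} =
           real n / real_of_int (int k - x) *
             (\<Sum>(a, b) \<in> {(a :: nat, b :: nat). int a + int b = int k + y - 2 * x}.
                real_of_int
                 (int_binom (int k - x) (int a)
                  * int_binom (x - 1) (int k - x - int a - 1)
                  * int_binom (int k - x) (int b)
                  * int_binom (int n - 2 * int k + x - 1) (int k - x - int b - 1)))"
proof -
  obtain x' y' where xy: "x = int x'" "y = int y'"
    using assms(4,6) by (metis nonneg_int_cases)
  have lt: "x' < k" using assms(5) xy by simp
  have le: "2 * k \<le> n" using assms(3) by linarith
  define S where "S = {A \<in> k_subsets n k. incidences n 1 A = x \<and> incidences n 2 A = y}"
  let ?I = "{(a, b). a + b + 2 * x' = k + y'}"
  let ?F = "\<lambda>a b. int_binom (int k - x) (int a) * int_binom (x - 1) (int k - x - int a - 1)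
    * int_binom (int k - x) (int b) * int_binom (int n - 2 * int k + x - 1) (int k - x - int b - 1)"
  have I: "{(a :: nat, b :: nat). int a + int b = int k + y - 2 * x} = ?I"
    using xy by auto
  \<comment> \<open>\<open>lt\<close> and \<open>le\<close> make the natural subtractions
    \<open>k - x'\<close> and \<open>n + x' - 2 * k\<close> agree with the integer ones.\<close>
  have F: "int (card (sum_zeros_lists (k - x') x' a) *
      card (sum_zeros_lists (k - x') (n + x' - 2 * k) b)) = ?F a b" for a b
    using lt le xy by (simp add: card_sum_zeros_lists of_nat_diff algebra_simps)
  have "int ((k - x') * card S) = int n * (\<Sum>(a, b) \<in> ?I. ?F a b)"
    unfolding S_def xy card_subsets_corr_words card_corr_words[OF lt le] of_nat_mult[of n] of_nat_sum
    using F unfolding xy by (simp add: case_prod_unfold del: of_nat_mult)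
  then have "real_of_int (int ((k - x') * card S)) = real_of_int (int n * (\<Sum>(a, b) \<in> ?I. ?F a b))"
    by (rule arg_cong)
  then have "real_of_int (int k - x) * real (card S) =
      real n * (\<Sum>(a, b) \<in> ?I. real_of_int (?F a b))"
    using lt xy by (simp add: of_nat_diff case_prod_unfold)
  moreover have "real_of_int (int k - x) > 0" using lt xy by simp
  ultimately have "real (card S) =
      real n / real_of_int (int k - x) * (\<Sum>(a, b) \<in> ?I. real_of_int (?F a b))"
    by (simp add: field_simps)
  moreover have "real (n choose k) * measure_pmf.prob (uniform_k_subset n k)
      {A. incidences n 1 A = x \<and> incidences n 2 A = y} = real (card S)"
    unfolding S_def by (rule prob_uniform_k_subset) (use le in simp)
  ultimately show ?thesis
    unfolding I S_def by simp
qed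

end
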